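(* Let $h=(C_1,\dots,C_n)$ be a concrete heap, let $\mathit{depth}$ be a given function on nodes, and let remove-node and remove-nodes be any procedures that always terminate and return a triple. Then the algorithm Heap-Abstract, run on $h$, always terminates (for every choice made during its execution).
   Context: A concrete heap is a finite sequence of disjoint labeled directed graphs (components) $C_i=(V_i,A_i,P_i)$, each with a layout attribute in $\{\mathit{SLL},\mathit{T},\mathit{C},\mathit{DAG}\}$, where $V_i$ is a finite set of variables, $A_i$ a finite set of memory addresses (nodes), $P_i\subseteq(V_i\times A_i)\cup(A_i\times A_i)$ for layouts $\mathit{SLL},\mathit{C},\mathit{DAG}$, and $P_i\subseteq(V_i\times A_i)\cup(A_i\times A_i\times\{l,r\})$ for layout $\mathit{T}$. Algorithm Heap-Abstract: for $i=1,\dots,n$, set $\hat{C}_i$ to Abstract-SLL$(C_i)$, Abstract-T$(C_i)$, Abstract-C$(C_i)$ or Abstract-DAG$(C_i)$ according as $C_i.\mathit{layout}$ is $\mathit{SLL}$, $\mathit{T}$, $\mathit{C}$ or $\mathit{DAG}$; return $(\hat{C}_1,\dots,\hat{C}_n)$. In what follows a component is written $(\hat{V},\hat{N},\hat{P})$. Abstract-SLL: a node $n$ is special if $(v,n)\in\hat{P}$ for some variable $v$, or $n\in\{a,b\}$ for some $(a,b)\in\hat{P}$ with $a,b\in\hat{N}$ and $\mathit{depth}(a)>\mathit{depth}(b)$; ordinary otherwise. $M\leftarrow$ ordinary nodes; while there are $a\neq b$ in $M$ with $(a,b)\in\hat{P}$: $(\hat{V},\hat{N},\hat{P})\leftarrow$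 remove-node$(b,\hat{V},\hat{N},\hat{P})$, $\hat{P}\leftarrow\hat{P}\cup\{(a,a)\}$, $M\leftarrow M\setminus\{b\}$; return the triple. Abstract-T (input of height $h_T$): a node $n$ is special if $(v,n)\in\hat{P}$ for some variable $v$, or $n\in\{a,b\}$ for some $(a,b,x)\in\hat{P}$ with $a\neq b$ and $\mathit{depth}(a)\ge\mathit{depth}(b)$; ordinary otherwise. $M\leftarrow$ ordinary nodes; for $i=h_T-1$ down to $1$: while $M$ has pairwise distinct $a,b,c$ with $\mathit{depth}(a)=i$, $(a,b,l),(a,c,r)\in\hat{P}$: $(\hat{V},\hat{N},\hat{P})\leftarrow$ remove-nodes$(b,c,\hat{V},\hat{N},\hat{P})$, $\hat{P}\leftarrow\hat{P}\cup\{(a,a,l),(a,a,r)\}$, $M\leftarrow M\setminus\{b,c\}$; return the triple. Abstract-C: for $n\in\hat{N}$ let $P_{in}(\{n\})=\{(x,n)\in\hat{P}\mid x\in\hat{N}\setminus\{n\}\}$, $P_{out}(\{n\})=\{(n,x)\in\hat{P}\mid x\in\hat{N}\setminus\{n\}\}$; $n$ is special if pointed to by a variable or $|P_{in}(\{n\})|>1$ or $|P_{out}(\{n\})|>1$, ordinary otherwise. $M\leftarrow$ ordinary nodes; while there are $a\neq b$ in $M$ with $(a,b)\in\hat{P}$: while some $(b,c)\in\hat{P}$ exists, replace it by $(a,c)$; $\hat{N}\leftarrow\hat{N}\setminus\{b\}$; $\hat{P}\leftarrow(\hat{P}\setminus\{(a,b)\})\cup\{(a,a)\}$; $M\leftarrow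 M\setminus\{b\}$; return the triple. Abstract-DAG: a node is special if pointed to by a variable, ordinary otherwise; distinct $a,b$ are reference similar if $(a,b),(b,a)\notin\hat{P}$ and $a,b$ have the same sets of node predecessors and of node successors; a set is reference similar if all its distinct pairs are. Ref-similar-DAG: $G\leftarrow\emptyset$, $M\leftarrow$ ordinary nodes; while $M\neq\emptyset$: pick $a\in M$, $A\leftarrow\{a\}$, for every $b\in M$ if $A\cup\{b\}$ is reference similar then $A\leftarrow A\cup\{b\}$; $G\leftarrow G\cup\{A\}$, $M\leftarrow M\setminus A$; return $G$. Abstract-DAG then takes every $A=\{a_1,\dots,a_n\}$ in Ref-similar-DAG's output with $|A|>1$, removes $a_2,\dots,a_n$ from $\hat{N}$ and all pointers having one of them as an endpoint from $\hat{P}$, adds $(a_1,a_1)$ to $\hat{P}$, and returns the resulting triple. *)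

theory Defs
  imports Main
begin

datatype layout = Layout_SLL | Layout_T | Layout_C | Layout_DAG

datatype side = Lft | Rgt

text \<open>One pointer type serves all layouts: \<open>VarPtr v a\<close> is the pair \<open>(v, a)\<close>, \<open>Ptr a b\<close> the pair
  \<open>(a, b)\<close> and \<open>TPtr a b x\<close> the triple \<open>(a, b, x)\<close>. Which of them may occur in a component is
  fixed by \<open>component_ok\<close>.\<close>

datatype ('v, 'n) ptr = VarPtr 'v 'n | Ptr 'n 'n | TPtr 'n 'n side

type_synonym ('v, 'n) triple = "'v set \<times> 'n set \<times> ('v, 'n) ptr set"

type_synonym ('v, 'n) component = "layout \<times> ('v, 'n) triple"

fun component_ok :: "('v, 'n) component \<Rightarrow> bool" where
  "component_ok (lay, V, N, P) \<longleftrightarrow>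
     finite V \<and> finite N \<and>
     P \<subseteq> {VarPtr v a | v a. v \<in> V \<and> a \<in> N} \<union>
         (if lay = Layout_T then {TPtr a b x | a b x. a \<in> N \<and> b \<in> N}
          else {Ptr a b | a b. a \<in> N \<and> b \<in> N})"

fun disjoint_components :: "('v, 'n) component \<Rightarrow> ('v, 'n) component \<Rightarrow> bool" where
  "disjoint_components (_, V, N, _) (_, V', N', _) \<longleftrightarrow> V \<inter> V' = {} \<and> N \<inter> N' = {}"

definition concrete_heap :: "('v, 'n) component list \<Rightarrow> bool" where
  "concrete_heap h \<longleftrightarrow> (\<forall>c \<in> set h. component_ok c) \<and>
     (\<forall>i < length h. \<forall>j < length h. i \<noteq> j \<longrightarrow> disjoint_components (h ! i) (h ! j))"


definition var_pointed :: "('v, 'n) triple \<Rightarrow> 'n \<Rightarrow> bool" where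
  "var_pointed = (\<lambda>(V, N, P) n. \<exists>v \<in> V. VarPtr v n \<in> P)"

definition special_SLL :: "('n \<Rightarrow> nat) \<Rightarrow> ('v, 'n) triple \<Rightarrow> 'n \<Rightarrow> bool" where
  "special_SLL depth = (\<lambda>(V, N, P) n. var_pointed (V, N, P) n \<or>
     (\<exists>a \<in> N. \<exists>b \<in> N. Ptr a b \<in> P \<and> depth a > depth b \<and> n \<in> {a, b}))"

definition special_T :: "('n \<Rightarrow> nat) \<Rightarrow> ('v, 'n) triple \<Rightarrow> 'n \<Rightarrow> bool" where
  "special_T depth = (\<lambda>(V, N, P) n. var_pointed (V, N, P) n \<or>
     (\<exists>a b x. TPtr a b x \<in> P \<and> a \<noteq> b \<and> depth a \<ge> depth b \<and> n \<in> {a, b}))"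

definition special_C :: "('v, 'n) triple \<Rightarrow> 'n \<Rightarrow> bool" where
  "special_C = (\<lambda>(V, N, P) n. var_pointed (V, N, P) n \<or>
     card {p \<in> P. \<exists>x \<in> N - {n}. p = Ptr x n} > 1 \<or>
     card {p \<in> P. \<exists>x \<in> N - {n}. p = Ptr n x} > 1)"

definition ordinary :: "(('v, 'n) triple \<Rightarrow> 'n \<Rightarrow> bool) \<Rightarrow> ('v, 'n) triple \<Rightarrow> 'n set" where
  "ordinary special = (\<lambda>(V, N, P). {n \<in> N. \<not> special (V, N, P) n})"

definition ref_similar :: "('v, 'n) triple \<Rightarrow> 'n \<Rightarrow> 'n \<Rightarrow> bool" where
  "ref_similar = (\<lambda>(V, N, P) a b. Ptr a b \<notin> P \<and> Ptr b a \<notin> P \<and>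
     {x \<in> N. Ptr x a \<in> P} = {x \<in> N. Ptr x b \<in> P} \<and>
     {x \<in> N. Ptr a x \<in> P} = {x \<in> N. Ptr b x \<in> P})"

definition ref_similar_set :: "('v, 'n) triple \<Rightarrow> 'n set \<Rightarrow> bool" where
  "ref_similar_set t A \<longleftrightarrow> (\<forall>a \<in> A. \<forall>b \<in> A. a \<noteq> b \<longrightarrow> ref_similar t a b)"

fun ptr_nodes :: "('v, 'n) ptr \<Rightarrow> 'n set" where
  "ptr_nodes (VarPtr v a) = {a}"
| "ptr_nodes (Ptr a b) = {a, b}"
| "ptr_nodes (TPtr a b x) = {a, b}"

fun add_ptrs :: "('v, 'n) ptr set \<Rightarrow> ('v, 'n) triple \<Rightarrow> ('v, 'n) triple" where
  "add_ptrs Q (V, N, P) = (V, N, P \<union> Q)"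


text \<open>A call of a possibly nondeterministic procedure is described by the set of its possible
  outcomes; a run that never returns has outcome \<open>Diverges\<close>.\<close>

datatype 'a outcome = Diverges | Returns 'a

definition always_returns :: "'a outcome set \<Rightarrow> bool" where
  "always_returns X \<longleftrightarrow> X \<noteq> {} \<and> Diverges \<notin> X"


text \<open>Control points of the four component algorithms, together with the values of the program
  variables that are live there. In \<open>DAG_For t G M A S\<close>, the set \<open>S\<close> holds the \<open>b \<in> M\<close> that
  the for-loop of Ref-similar-DAG has still to visit; in \<open>DAG_Merge G t\<close>, \<open>G\<close> holds the groups
  that Abstract-DAG has still to treat.\<close>

datatype ('v, 'n) pstate =
    SLL_While "('v, 'n) triple" "'n set"
  | SLL_Call 'n 'n "('v, 'n) triple" "'n set"
  | T_For nat "('v, 'n) triple" "'n set"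
  | T_Call nat 'n 'n 'n "('v, 'n) triple" "'n set"
  | C_While "('v, 'n) triple" "'n set"
  | C_Inner 'n 'n "('v, 'n) triple" "'n set"
  | DAG_While "('v, 'n) triple" "'n set set" "'n set"
  | DAG_For "('v, 'n) triple" "'n set set" "'n set" "'n set" "'n set"
  | DAG_Merge "'n set set" "('v, 'n) triple"
  | Diverging
  | Result "('v, 'n) triple"

text \<open>The height of the input of Abstract-T, left undefined by the algorithm, is an arbitrary
  function of the input.\<close>

fun entry :: "('n \<Rightarrow> nat) \<Rightarrow> (('v, 'n) triple \<Rightarrow> nat) \<Rightarrow> ('v, 'n) component \<Rightarrow> ('v, 'n) pstate" where
  "entry depth height (Layout_SLL, t) = SLL_While t (ordinary (special_SLL depth) t)"
| "entry depth height (Layout_T, t) = T_For (height t - 1) t (ordinary (special_T depth) t)"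
| "entry depth height (Layout_C, t) = C_While t (ordinary special_C t)"
| "entry depth height (Layout_DAG, t) = DAG_While t {} (ordinary var_pointed t)"

inductive pstep ::
  "('n \<Rightarrow> nat) \<Rightarrow>
   ('n \<Rightarrow> ('v, 'n) triple \<Rightarrow> ('v, 'n) triple outcome set) \<Rightarrow>
   ('n \<Rightarrow> 'n \<Rightarrow> ('v, 'n) triple \<Rightarrow> ('v, 'n) triple outcome set) \<Rightarrow>
   ('v, 'n) pstate \<Rightarrow> ('v, 'n) pstate \<Rightarrow> bool"
  for depth remove_node remove_nodes
where
  SLL_iterate:
    "\<lbrakk>a \<in> M; b \<in> M; a \<noteq> b; Ptr a b \<in> P\<rbrakk> \<Longrightarrow>
     pstep depth remove_node remove_nodes (SLL_While (V, N, P) M) (SLL_Call a b (V, N, P) M)"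
| SLL_call:
    "Returns t' \<in> remove_node b t \<Longrightarrow>
     pstep depth remove_node remove_nodes
       (SLL_Call a b t M) (SLL_While (add_ptrs {Ptr a a} t') (M - {b}))"
| SLL_diverge:
    "Diverges \<in> remove_node b t \<Longrightarrow>
     pstep depth remove_node remove_nodes (SLL_Call a b t M) Diverging"
| SLL_exit:
    "\<not> (\<exists>a \<in> M. \<exists>b \<in> M. a \<noteq> b \<and> Ptr a b \<in> P) \<Longrightarrow>
     pstep depth remove_node remove_nodes (SLL_While (V, N, P) M) (Result (V, N, P))"

| T_iterate:
    "\<lbrakk>i \<ge> 1; a \<in> M; b \<in> M; c \<in> M; a \<noteq> b; a \<noteq> c; b \<noteq> c; depth a = i;
      TPtr a b Lft \<in> P; TPtr a c Rgt \<in> P\<rbrakk> \<Longrightarrow>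
     pstep depth remove_node remove_nodes (T_For i (V, N, P) M) (T_Call i a b c (V, N, P) M)"
| T_call:
    "Returns t' \<in> remove_nodes b c t \<Longrightarrow>
     pstep depth remove_node remove_nodes
       (T_Call i a b c t M) (T_For i (add_ptrs {TPtr a a Lft, TPtr a a Rgt} t') (M - {b, c}))"
| T_diverge:
    "Diverges \<in> remove_nodes b c t \<Longrightarrow>
     pstep depth remove_node remove_nodes (T_Call i a b c t M) Diverging"
| T_next:
    "\<lbrakk>i \<ge> 1;
      \<not> (\<exists>a \<in> M. \<exists>b \<in> M. \<exists>c \<in> M. a \<noteq> b \<and> a \<noteq> c \<and> b \<noteq> c \<and> depth a = i \<and>
           TPtr a b Lft \<in> P \<and> TPtr a c Rgt \<in> P)\<rbrakk> \<Longrightarrow>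
     pstep depth remove_node remove_nodes (T_For i (V, N, P) M) (T_For (i - 1) (V, N, P) M)"
| T_exit:
    "pstep depth remove_node remove_nodes (T_For 0 t M) (Result t)"

| C_iterate:
    "\<lbrakk>a \<in> M; b \<in> M; a \<noteq> b; Ptr a b \<in> P\<rbrakk> \<Longrightarrow>
     pstep depth remove_node remove_nodes (C_While (V, N, P) M) (C_Inner a b (V, N, P) M)"
| C_inner_iterate:
    "Ptr b c \<in> P \<Longrightarrow>
     pstep depth remove_node remove_nodes
       (C_Inner a b (V, N, P) M) (C_Inner a b (V, N, (P - {Ptr b c}) \<union> {Ptr a c}) M)"
| C_inner_exit:
    "\<not> (\<exists>c. Ptr b c \<in> P) \<Longrightarrow>
     pstep depth remove_node remove_nodes
       (C_Inner a b (V, N, P) M) (C_While (V, N - {b}, (P - {Ptr a b}) \<union> {Ptr a a}) (M - {b}))"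
| C_exit:
    "\<not> (\<exists>a \<in> M. \<exists>b \<in> M. a \<noteq> b \<and> Ptr a b \<in> P) \<Longrightarrow>
     pstep depth remove_node remove_nodes (C_While (V, N, P) M) (Result (V, N, P))"

| DAG_pick:
    "a \<in> M \<Longrightarrow>
     pstep depth remove_node remove_nodes (DAG_While t G M) (DAG_For t G M {a} M)"
| DAG_extend:
    "\<lbrakk>b \<in> S; ref_similar_set t (A \<union> {b})\<rbrakk> \<Longrightarrow>
     pstep depth remove_node remove_nodes
       (DAG_For t G M A S) (DAG_For t G M (A \<union> {b}) (S - {b}))"
| DAG_skip:
    "\<lbrakk>b \<in> S; \<not> ref_similar_set t (A \<union> {b})\<rbrakk> \<Longrightarrow>
     pstep depth remove_node remove_nodes (DAG_For t G M A S) (DAG_For t G M A (S - {b}))"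
| DAG_group:
    "pstep depth remove_node remove_nodes
       (DAG_For t G M A {}) (DAG_While t (G \<union> {A}) (M - A))"
| DAG_grouped:
    "pstep depth remove_node remove_nodes (DAG_While t G {}) (DAG_Merge G t)"
| DAG_merge:
    "\<lbrakk>A \<in> G; card A > 1; a \<in> A\<rbrakk> \<Longrightarrow>
     pstep depth remove_node remove_nodes
       (DAG_Merge G (V, N, P))
       (DAG_Merge (G - {A})
         (V, N - (A - {a}), {p \<in> P. ptr_nodes p \<inter> (A - {a}) = {}} \<union> {Ptr a a}))"
| DAG_small:
    "\<lbrakk>A \<in> G; \<not> card A > 1\<rbrakk> \<Longrightarrow>
     pstep depth remove_node remove_nodes (DAG_Merge G t) (DAG_Merge (G - {A}) t)"
| DAG_exit:
    "pstep depth remove_node remove_nodes (DAG_Merge {} t) (Result t)"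

| diverge:
    "pstep depth remove_node remove_nodes Diverging Diverging"


text \<open>In the states below, the first list holds the abstract components computed so far and the
  list of components those that the main loop has not yet reached.\<close>

datatype ('v, 'n) hstate =
    At_Loop "('v, 'n) triple list" "('v, 'n) component list"
  | Running "('v, 'n) triple list" "('v, 'n) pstate" "('v, 'n) component list"
  | Returned "('v, 'n) triple list"

inductive heap_abstract_step ::
  "('n \<Rightarrow> nat) \<Rightarrow> (('v, 'n) triple \<Rightarrow> nat) \<Rightarrow>
   ('n \<Rightarrow> ('v, 'n) triple \<Rightarrow> ('v, 'n) triple outcome set) \<Rightarrow>
   ('n \<Rightarrow> 'n \<Rightarrow> ('v, 'n) triple \<Rightarrow> ('v, 'n) triple outcome set) \<Rightarrow>
   ('v, 'n) hstate \<Rightarrow> ('v, 'n) hstate \<Rightarrow> bool"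
  for depth height remove_node remove_nodes
where
  call_component:
    "heap_abstract_step depth height remove_node remove_nodes
       (At_Loop ds (c # cs)) (Running ds (entry depth height c) cs)"
| run_component:
    "pstep depth remove_node remove_nodes s s' \<Longrightarrow>
     heap_abstract_step depth height remove_node remove_nodes
       (Running ds s cs) (Running ds s' cs)"
| component_done:
    "heap_abstract_step depth height remove_node remove_nodes
       (Running ds (Result t) cs) (At_Loop (ds @ [t]) cs)"
| return_heap:
    "heap_abstract_step depth height remove_node remove_nodes (At_Loop ds []) (Returned ds)"

text \<open>Termination for every choice: there is no infinite execution, and an execution that cannot
  be continued has reached a final state (rather than being stuck elsewhere).\<close>

definition always_terminates :: "('s \<Rightarrow> 's \<Rightarrow> bool) \<Rightarrow> ('s \<Rightarrow> bool) \<Rightarrow> 's \<Rightarrow> bool" where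
  "always_terminates step final s \<longleftrightarrow>
     \<not> (\<exists>f. f 0 = s \<and> (\<forall>i::nat. step (f i) (f (Suc i)))) \<and>
     (\<forall>s'. step\<^sup>*\<^sup>* s s' \<and> \<not> (\<exists>s''. step s' s'') \<longrightarrow> final s')"

definition heap_abstract_terminates ::
  "('n \<Rightarrow> nat) \<Rightarrow> (('v, 'n) triple \<Rightarrow> nat) \<Rightarrow>
   ('n \<Rightarrow> ('v, 'n) triple \<Rightarrow> ('v, 'n) triple outcome set) \<Rightarrow>
   ('n \<Rightarrow> 'n \<Rightarrow> ('v, 'n) triple \<Rightarrow> ('v, 'n) triple outcome set) \<Rightarrow>
   ('v, 'n) component list \<Rightarrow> bool" where
  "heap_abstract_terminates depth height remove_node remove_nodes h \<longleftrightarrow>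
     always_terminates (heap_abstract_step depth height remove_node remove_nodes)
       (\<lambda>s. \<exists>ds. s = Returned ds) (At_Loop [] h)"

end

theory Submission
  imports Defs
begin

text \<open>Every loop shrinks a finite set: the candidate set \<open>M\<close> in the outer loops (in Abstract-T
  nested inside the descending counter), the pointers leaving \<open>b\<close> in the inner loop of Abstract-C, and the
  nodes or groups not yet visited in Abstract-DAG. Hence a lexicographic rank decreases in every
  step, whatever triples remove-node and remove-nodes return.\<close>

text \<open>Every run from \<open>s\<close> stays inside \<open>I\<close>, so an infinite one would
  be an infinite descending chain of \<open>R\<close>, and a stuck reachable state must be final by
  \<open>progress\<close>. The invariant confines the decrease to well-formed states.\<close>

lemma always_terminatesI:
  assumes wf: "wf R"
    and init: "I s"
    and decrease: "\<And>x y. I x \<Longrightarrow> step x y \<Longrightarrow> I y \<and> (y, x) \<in> R"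
    and progress: "\<And>x. I x \<Longrightarrow> \<not> final x \<Longrightarrow> \<exists>y. step x y"
  shows "always_terminates step final s"
  unfolding always_terminates_def
proof (intro conjI allI impI notI)
  assume "\<exists>f. f 0 = s \<and> (\<forall>i::nat. step (f i) (f (Suc i)))"
  then obtain f where f0: "f 0 = s" and f: "\<And>i::nat. step (f i) (f (Suc i))"
    by blast
  have "I (f i)" for i
    by (induction i) (use f0 init decrease f in auto)
  then have "(f (Suc i), f i) \<in> R" for i
    using decrease f by blast
  then show False
    using wf unfolding wf_iff_no_infinite_down_chain by blast
next
  fix s' assume s': "step\<^sup>*\<^sup>* s s' \<and> \<not> (\<exists>s''. step s' s'')"
  from s' have "step\<^sup>*\<^sup>* s s'" ..
  then have "I s'"
    by (induction rule: rtranclp_induct) (use init decrease in auto)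
  then show "final s'"
    using s' progress by blast
qed

text \<open>Images of finite products cover \<open>P\<close>. Abstract-C relies on this, because its
  inner loop is measured by a number of pointers.\<close>

lemma component_ok_finite_ptrs:
  assumes "component_ok (lay, V, N, P)"
  shows "finite P"
proof -
  have "P \<subseteq> (\<lambda>(v, a). VarPtr v a) ` (V \<times> N) \<union> (\<lambda>(a, b). Ptr a b) ` (N \<times> N)
      \<union> (\<lambda>(a, b, x). TPtr a b x) ` (N \<times> N \<times> {Lft, Rgt})"
  proof
    fix p assume "p \<in> P"
    with assms have "p \<in> {VarPtr v a | v a. v \<in> V \<and> a \<in> N} \<union> {Ptr a b | a b. a \<in> N \<and> b \<in> N}
        \<union> {TPtr a b x | a b x. a \<in> N \<and> b \<in> N}"
      by (auto split: if_splits)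
    moreover have "x \<in> {Lft, Rgt}" for x
      by (cases x) auto
    ultimately show "p \<in> (\<lambda>(v, a). VarPtr v a) ` (V \<times> N) \<union> (\<lambda>(a, b). Ptr a b) ` (N \<times> N)
      \<union> (\<lambda>(a, b, x). TPtr a b x) ` (N \<times> N \<times> {Lft, Rgt})"
      by (cases p) (auto simp: image_iff)
  qed
  then show ?thesis
    using assms by (auto intro: finite_subset)
qed

lemma finite_ptr_targets: "finite P \<Longrightarrow> finite {c. Ptr b c \<in> P}"
  by (rule finite_vimageI[of P "Ptr b", unfolded vimage_def]) (auto simp: inj_on_def)

text \<open>The clauses record what strict decrease needs: finiteness, since \<open>card\<close> is
  0 on infinite sets; \<open>b \<in> M\<close>, so that dropping \<open>b\<close> shrinks
  \<open>M\<close>; a common element of \<open>A\<close> and \<open>M\<close>, so that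
  \<open>M - A\<close> is smaller. Nothing is said about the triples of Abstract-SLL and Abstract-T,
  as the removal procedures may return any triple.\<close>

fun pstate_ok :: "('v, 'n) pstate \<Rightarrow> bool" where
  "pstate_ok (SLL_While t M) \<longleftrightarrow> finite M"
| "pstate_ok (SLL_Call a b t M) \<longleftrightarrow> finite M \<and> b \<in> M"
| "pstate_ok (T_For i t M) \<longleftrightarrow> finite M"
| "pstate_ok (T_Call i a b c t M) \<longleftrightarrow> finite M \<and> b \<in> M"
| "pstate_ok (C_While (V, N, P) M) \<longleftrightarrow> finite M \<and> finite P"
| "pstate_ok (C_Inner a b (V, N, P) M) \<longleftrightarrow> finite M \<and> finite P \<and> a \<noteq> b \<and> b \<in> M"
| "pstate_ok (DAG_While t G M) \<longleftrightarrow> finite M \<and> finite G"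
| "pstate_ok (DAG_For t G M A S) \<longleftrightarrow> finite M \<and> finite G \<and> finite S \<and> A \<inter> M \<noteq> {}"
| "pstate_ok (DAG_Merge G t) \<longleftrightarrow> finite G"
| "pstate_ok Diverging \<longleftrightarrow> False"
| "pstate_ok (Result t) \<longleftrightarrow> True"

text \<open>The leading offsets put \<open>Result\<close> below all loop states and
  \<open>DAG_Merge\<close> below the grouping phase, even when \<open>M\<close> is empty. A loop
  head outranks its body through a 1 against a 0, placed before any inner count. In Abstract-T the
  counter comes first, since \<open>T_next\<close> leaves \<open>M\<close> unchanged.\<close>

fun pstate_rank :: "('v, 'n) pstate \<Rightarrow> nat \<times> nat \<times> nat" where
  "pstate_rank (SLL_While t M) = (1 + card M, 1, 0)"
| "pstate_rank (SLL_Call a b t M) = (1 + card M, 0, 0)"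
| "pstate_rank (T_For i t M) = (1 + i, card M, 1)"
| "pstate_rank (T_Call i a b c t M) = (1 + i, card M, 0)"
| "pstate_rank (C_While t M) = (1 + card M, 1, 0)"
| "pstate_rank (C_Inner a b (V, N, P) M) = (1 + card M, 0, card {c. Ptr b c \<in> P})"
| "pstate_rank (DAG_While t G M) = (2 + card M, 1, 0)"
| "pstate_rank (DAG_For t G M A S) = (2 + card M, 0, card S)"
| "pstate_rank (DAG_Merge G t) = (1, card G, 0)"
| "pstate_rank Diverging = (0, 0, 0)"
| "pstate_rank (Result t) = (0, 0, 0)"

abbreviation rank_less :: "((nat \<times> nat \<times> nat) \<times> (nat \<times> nat \<times> nat)) set" where
  "rank_less \<equiv> less_than <*lex*> less_than <*lex*> less_than"

text \<open>A diverging call contradicts \<open>always_returns\<close>, and the self-loop of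
  \<open>Diverging\<close> contradicts the invariant; every other step lowers the component of the
  rank designed for it.\<close>

lemma pstep_decreases_rank:
  assumes "pstep depth remove_node remove_nodes s s'"
    and "pstate_ok s"
    and "\<And>b t. always_returns (remove_node b t)"
    and "\<And>b c t. always_returns (remove_nodes b c t)"
  shows "pstate_ok s' \<and> (pstate_rank s', pstate_rank s) \<in> rank_less"
  using assms(1,2)
proof (cases rule: pstep.cases)
  case (SLL_diverge b t a M)
  then show ?thesis
    using assms(3) by (auto simp: always_returns_def)
next
  case (T_diverge b c t i a M)
  then show ?thesis
    using assms(4) by (auto simp: always_returns_def)
next
  case (SLL_call t' b t a M)
  then show ?thesis
    using assms(2) by (auto intro!: diff_less simp: card_gt_0_iff)
next
  case (T_call t' b c t i a M)
  then have "card (M - {b, c}) < card M"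
    using assms(2) by (intro psubset_card_mono) auto
  then show ?thesis
    using T_call assms(2) by auto
next
  case (C_inner_iterate b c P a V N M)
  \<comment> \<open>The target \<open>c\<close> is lost, and the new pointer \<open>Ptr a c\<close>
    is not counted because the invariant gives \<open>a \<noteq> b\<close>.\<close>
  then have "card {d. Ptr b d \<in> (P - {Ptr b c}) \<union> {Ptr a c}} < card {d. Ptr b d \<in> P}"
    using assms(2) by (intro psubset_card_mono finite_ptr_targets) auto
  then show ?thesis
    using C_inner_iterate assms(2) by simp
next
  case (C_inner_exit b P a V N M)
  then show ?thesis
    using assms(2) by (auto intro!: diff_less simp: card_gt_0_iff)
next
  case (DAG_extend b S t A G M)
  then show ?thesis
    using assms(2) by (auto intro!: diff_less simp: card_gt_0_iff)
next
  case (DAG_skip b S t A G M)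
  then show ?thesis
    using assms(2) by (auto intro!: diff_less simp: card_gt_0_iff)
next
  case (DAG_group t G M A)
  \<comment> \<open>The group started from an element picked in \<open>M\<close> and only grew, so
    it still meets \<open>M\<close>.\<close>
  then have "card (M - A) < card M"
    using assms(2) by (intro psubset_card_mono) auto
  then show ?thesis
    using DAG_group assms(2) by auto
next
  case (DAG_merge A G a V N P)
  then show ?thesis
    using assms(2) by (auto intro!: diff_less simp: card_gt_0_iff)
next
  case (DAG_small A G t)
  then show ?thesis
    using assms(2) by (auto intro!: diff_less simp: card_gt_0_iff)
qed auto

lemma always_returns_outcome: "always_returns X \<Longrightarrow> \<exists>x. Returns x \<in> X"
  unfolding always_returns_def by (metis ex_in_conv outcome.exhaust)

text \<open>The rules at each loop have complementary guards, and a call has at least one returning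
  outcome. \<open>Diverging\<close> is not stuck, as it steps to itself.\<close>

lemma pstep_progress:
  assumes "\<And>b t. always_returns (remove_node b t)"
    and "\<And>b c t. always_returns (remove_nodes b c t)"
    and "\<nexists>t. s = Result t"
  shows "\<exists>s'. pstep depth remove_node remove_nodes s s'"
proof (cases s)
  case (SLL_While t M)
  then show ?thesis
    by (cases t) (blast intro: SLL_iterate SLL_exit)
next
  case (SLL_Call a b t M)
  then show ?thesis
    using always_returns_outcome[OF assms(1)[of b t]] by (blast intro: SLL_call)
next
  case (T_For i t M)
  obtain V N P where t: "t = (V, N, P)"
    by (cases t)
  show ?thesis
  proof (cases "i = 0")
    case True
    then show ?thesis
      using T_For T_exit by metis
  next
    case False
    then have "1 \<le> i"
      by simp
    then show ?thesis
      unfolding T_For t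
      by (blast intro: T_iterate T_next)
  qed
next
  case (T_Call i a b c t M)
  then show ?thesis
    using always_returns_outcome[OF assms(2)[of b c t]] by (blast intro: T_call)
next
  case (C_While t M)
  then show ?thesis
    by (cases t) (blast intro: C_iterate C_exit)
next
  case (C_Inner a b t M)
  then show ?thesis
    by (cases t) (blast intro: C_inner_iterate C_inner_exit)
next
  case (DAG_While t G M)
  then show ?thesis
    by (cases "M = {}") (blast intro: DAG_pick DAG_grouped)+
next
  case (DAG_For t G M A S)
  then show ?thesis
    by (cases "S = {}") (blast intro: DAG_extend DAG_skip DAG_group)+
next
  case (DAG_Merge G t)
  show ?thesis
  proof (cases "G = {}")
    case True
    then show ?thesis
      using DAG_Merge DAG_exit by metis
  next
    case False
    then obtain A where A: "A \<in> G"
      by blast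
    obtain V N P where t: "t = (V, N, P)"
      by (cases t)
    show ?thesis
    proof (cases "card A > 1")
      case True
      \<comment> \<open>Any element can be the survivor of the merge; one exists because the empty
        set has cardinality 0.\<close>
      then obtain a where "a \<in> A"
        by fastforce
      with A True show ?thesis
        unfolding DAG_Merge t by (blast intro: DAG_merge)
    next
      case False
      with A show ?thesis
        unfolding DAG_Merge by (blast intro: DAG_small)
    qed
  qed
next
  case Diverging
  then show ?thesis
    using diverge by metis
qed (use assms(3) in blast)

lemma pstate_ok_entry:
  assumes "component_ok c"
  shows "pstate_ok (entry depth height c)"
proof -
  obtain lay V N P where c: "c = (lay, V, N, P)"
    by (cases c)
  have "finite N" "finite P"
    using assms component_ok_finite_ptrs unfolding c by auto
  then show ?thesis
    unfolding c by (cases lay) (auto simp: ordinary_def)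
qed

fun hstate_ok :: "('v, 'n) hstate \<Rightarrow> bool" where
  "hstate_ok (At_Loop ds cs) \<longleftrightarrow> (\<forall>c \<in> set cs. component_ok c)"
| "hstate_ok (Running ds s cs) \<longleftrightarrow> pstate_ok s \<and> (\<forall>c \<in> set cs. component_ok c)"
| "hstate_ok (Returned ds) \<longleftrightarrow> True"

text \<open>Each pending component weighs 2, so the leading entry drops by 1 when a component is
  started and by 1 when it is finished. In between it is constant and the rank of the running
  algorithm decides.\<close>

fun hstate_rank :: "('v, 'n) hstate \<Rightarrow> nat \<times> nat \<times> nat \<times> nat" where
  "hstate_rank (At_Loop ds cs) = (2 * length cs + 1, 0, 0, 0)"
| "hstate_rank (Running ds s cs) = (2 * length cs + 2, pstate_rank s)"
| "hstate_rank (Returned ds) = (0, 0, 0, 0)"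

lemma heap_abstract_step_decreases_rank:
  assumes "heap_abstract_step depth height remove_node remove_nodes s s'"
    and "hstate_ok s"
    and "\<And>b t. always_returns (remove_node b t)"
    and "\<And>b c t. always_returns (remove_nodes b c t)"
  shows "hstate_ok s' \<and> (hstate_rank s', hstate_rank s) \<in> less_than <*lex*> rank_less"
  using assms(1)
proof (cases rule: heap_abstract_step.cases)
  case (call_component ds c cs)
  then show ?thesis
    using assms(2) by (auto simp: pstate_ok_entry)
next
  case (run_component s s' ds cs)
  then show ?thesis
    using assms(2) pstep_decreases_rank[OF run_component(3) _ assms(3,4)] by simp
qed (use assms(2) in auto)

lemma heap_abstract_step_progress:
  assumes "\<And>b t. always_returns (remove_node b t)"
    and "\<And>b c t. always_returns (remove_nodes b c t)"
    and "\<nexists>ds. s = Returned ds"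
  shows "\<exists>s'. heap_abstract_step depth height remove_node remove_nodes s s'"
proof (cases s)
  case (At_Loop ds cs)
  then show ?thesis
    by (cases cs) (metis return_heap, metis call_component)
next
  case (Running ds p cs)
  then show ?thesis
    using pstep_progress[of remove_node remove_nodes p depth, OF assms(1,2)]
    \<comment> \<open>\<open>Result\<close> has no \<open>pstep\<close> successor; there the main
      loop takes over through \<open>component_done\<close>.\<close>
    by (cases "\<exists>t. p = Result t") (blast intro: run_component component_done)+
qed (use assms(3) in blast)

theorem theorem11:
  fixes h :: "('v, 'n) component list"
    and depth :: "'n \<Rightarrow> nat"
    and height :: "('v, 'n) triple \<Rightarrow> nat"
    and remove_node :: "'n \<Rightarrow> ('v, 'n) triple \<Rightarrow> ('v, 'n) triple outcome set"
    and remove_nodes :: "'n \<Rightarrow> 'n \<Rightarrow> ('v, 'n) triple \<Rightarrow> ('v, 'n) triple outcome set"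
  assumes "concrete_heap h"
    and "\<And>b t. always_returns (remove_node b t)"
    and "\<And>b c t. always_returns (remove_nodes b c t)"
  shows "heap_abstract_terminates depth height remove_node remove_nodes h"
  unfolding heap_abstract_terminates_def
proof (rule always_terminatesI[where I = hstate_ok
      and R = "inv_image (less_than <*lex*> rank_less) hstate_rank"])
  show "wf (inv_image (less_than <*lex*> rank_less) hstate_rank)"
    by (intro wf_inv_image wf_lex_prod wf_less_than)
  show "hstate_ok (At_Loop [] h)"
    using assms(1) by (simp add: concrete_heap_def)
next
  fix x y :: "('v, 'n) hstate"
  assume "hstate_ok x" "heap_abstract_step depth height remove_node remove_nodes x y"
  then show "hstate_ok y \<and> (y, x) \<in> inv_image (less_than <*lex*> rank_less) hstate_rank"
    using heap_abstract_step_decreases_rank[OF _ _ assms(2,3)] by (simp only: in_inv_image)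
next
  fix x :: "('v, 'n) hstate"
  assume "\<not> (\<exists>ds. x = Returned ds)"
  then show "\<exists>y. heap_abstract_step depth height remove_node remove_nodes x y"
    by (rule heap_abstract_step_progress[OF assms(2,3)])
qed

end
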